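(* Let $n\ge 3$, and let $\vec{x}_1(t),\dots,\vec{x}_n(t)\in\mathbb{R}^2$ be differentiable functions of $t$ in an interval, with $\vec{x}_{i+1}(t)\neq\vec{x}_i(t)$ for $1\le i\le n$ (indices modulo $n$), and let $\lambda(t)\in\mathbb{R}$. Suppose that for every $t$ the vector $\dot X=(\dot{\vec{x}}_1^\top,\dots,\dot{\vec{x}}_n^\top,\lambda)^\top\in\mathbb{R}^{2n+1}$ is the solution of the discrete volume preserving mean curvature flow system $$\frac{\partial\Phi_h}{\partial\dot{\vec{x}}_i}+\lambda\frac{\partial (S_h)_t}{\partial\dot{\vec{x}}_i}=-\frac{\partial\mathcal{E}_h}{\partial\vec{x}_i}\quad(1\le i\le n),\qquad (S_h)_t=0,$$ where $\mathcal{E}_h$, $\Phi_h$ and $(S_h)_t$ are defined in the context. Then $$\frac{\mathrm{d}\mathcal{E}_h}{\mathrm{d}t}=-2\Phi_h\le 0,$$ and the equality $\frac{\mathrm{d}\mathcal{E}_h}{\mathrm{d}t}=0$ holds if and only if $\dot{\vec{x}}_i=0$ for all $1\le i\le n$.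
   Context: Indices are cyclic: $\vec{x}_{n+1}=\vec{x}_1$, $\vec{x}_0=\vec{x}_n$. The closed polygonal curve is $\Gamma_h(t)=\bigcup_{i=1}^n\Gamma_i(t)$, where $\Gamma_i(t)$ is the segment from $\vec{x}_i(t)$ to $\vec{x}_{i+1}(t)$, nodes being ordered counterclockwise. A dot denotes the time derivative. Discrete energy: $\mathcal{E}_h=\sum_{i=1}^n|\vec{x}_{i+1}-\vec{x}_i|$ (the length of $\Gamma_h$). Discrete velocity: at the point $(1-\mu)\vec{x}_i+\mu\vec{x}_{i+1}$ of $\Gamma_i$, $\mu\in[0,1]$, set $\vec{v}_h=(1-\mu)\dot{\vec{x}}_i+\mu\dot{\vec{x}}_{i+1}$. Discrete dissipation function: $\Phi_h=\frac12\int_{\Gamma_h}|\vec{v}_h|^2\,\mathrm{d}s=\frac12\sum_{i=1}^n|\vec{x}_{i+1}-\vec{x}_i|\int_0^1|(1-\mu)\dot{\vec{x}}_i+\mu\dot{\vec{x}}_{i+1}|^2\,\mathrm{d}\mu$, where $s$ is arc length; it is a quadratic form in $(\dot{\vec{x}}_i)$. Rate of change of the enclosed area $S_h$: with $P=\begin{pmatrix} 0 & 1 \\ -1 & 0 \end{pmatrix}$ and outward unit normals $\vec{n}_i=P(\vec{x}_{i+1}-\vec{x}_i)/|\vec{x}_{i+1}-\vec{x}_i|$, $(S_h)_t=\frac{\mathrm{d}S_h}{\mathrm{d}t}=\sum_{i=1}^n\int_{\Gamma_i}\vec{v}_h\cdot\vec{n}_i\,\mathrm{d}s$, a linear function of $(\dot{\vec{x}}_i)$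 with $\frac{\partial(S_h)_t}{\partial\dot{\vec{x}}_i}=\frac{P}{2}(\vec{x}_{i+1}-\vec{x}_{i-1})$. In matrix form the system reads $\hat A\dot X=\hat G$, where $\hat A=\begin{pmatrix} A & b \\ {b}^\top & 0 \end{pmatrix}$; $A$ is the $2n\times2n$ matrix with $2\times2$ blocks $A_{ii}=\frac{|\vec{x}_i-\vec{x}_{i-1}|+|\vec{x}_{i+1}-\vec{x}_i|}{3}I_2$, $A_{i,i+1}=A_{i+1,i}=\frac{|\vec{x}_{i+1}-\vec{x}_i|}{6}I_2$ (cyclic indices), other blocks zero, so that $\Phi_h=\frac12\dot X_0^\top A\dot X_0$ with $\dot X_0=(\dot{\vec{x}}_1^\top,\dots,\dot{\vec{x}}_n^\top)^\top$; $b\in\mathbb{R}^{2n}$ has $i$-th block $\frac{P}{2}(\vec{x}_{i+1}-\vec{x}_{i-1})$; and $\hat G=(\vec{g}_1^\top,\dots,\vec{g}_n^\top,0)^\top$ with $\vec{g}_i=-\frac{\partial\mathcal{E}_h}{\partial\vec{x}_i}=\frac{\vec{x}_{i+1}-\vec{x}_i}{|\vec{x}_{i+1}-\vec{x}_i|}-\frac{\vec{x}_i-\vec{x}_{i-1}}{|\vec{x}_i-\vec{x}_{i-1}|}$. *)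

theory Defs
  imports "HOL-Analysis.Analysis"
begin

text \<open>
  A closed polygon with \<open>n\<close> nodes is a map \<open>x :: nat \<Rightarrow> real ^ 2\<close> of which only the values at the
  indices \<open>{1..n}\<close> matter; nodal velocities \<open>v\<close> are represented in the same way.
\<close>

definition nxt :: "nat \<Rightarrow> nat \<Rightarrow> nat" where
  "nxt n i = (if i = n then 1 else Suc i)"

definition edge :: "nat \<Rightarrow> (nat \<Rightarrow> real ^ 2) \<Rightarrow> nat \<Rightarrow> real ^ 2" where
  "edge n x i = x (nxt n i) - x i"

definition P :: "real ^ 2 ^ 2" where
  "P = vector [vector [0, 1], vector [- 1, 0]]"

text \<open>Outward for counterclockwise node ordering.\<close>
definition edge_normal :: "nat \<Rightarrow> (nat \<Rightarrow> real ^ 2) \<Rightarrow> nat \<Rightarrow> real ^ 2" where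
  "edge_normal n x i = (P *v edge n x i) /\<^sub>R norm (edge n x i)"

text \<open>
  The integral with respect to arc length over the \<open>i\<close>-th edge of a function \<open>f\<close> of the parameter
  \<open>\<mu> \<in> [0, 1]\<close> of the point \<open>(1 - \<mu>) x\<^sub>i + \<mu> x\<^sub>i\<^sub>+\<^sub>1\<close>.
\<close>
definition edge_integral :: "nat \<Rightarrow> (nat \<Rightarrow> real ^ 2) \<Rightarrow> nat \<Rightarrow> (real \<Rightarrow> real) \<Rightarrow> real" where
  "edge_integral n x i f = norm (edge n x i) * integral {0..1} f"

definition edge_velocity :: "nat \<Rightarrow> (nat \<Rightarrow> real ^ 2) \<Rightarrow> nat \<Rightarrow> real \<Rightarrow> real ^ 2" where
  "edge_velocity n v i \<mu> = (1 - \<mu>) *\<^sub>R v i + \<mu> *\<^sub>R v (nxt n i)"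

definition discrete_energy :: "nat \<Rightarrow> (nat \<Rightarrow> real ^ 2) \<Rightarrow> real" where
  "discrete_energy n x = (\<Sum>i = 1..n. norm (edge n x i))"

definition dissipation :: "nat \<Rightarrow> (nat \<Rightarrow> real ^ 2) \<Rightarrow> (nat \<Rightarrow> real ^ 2) \<Rightarrow> real" where
  "dissipation n x v =
     1 / 2 * (\<Sum>i = 1..n. edge_integral n x i (\<lambda>\<mu>. (norm (edge_velocity n v i \<mu>))\<^sup>2))"

definition area_rate :: "nat \<Rightarrow> (nat \<Rightarrow> real ^ 2) \<Rightarrow> (nat \<Rightarrow> real ^ 2) \<Rightarrow> real" where
  "area_rate n x v =
     (\<Sum>i = 1..n. edge_integral n x i (\<lambda>\<mu>. edge_velocity n v i \<mu> \<bullet> edge_normal n x i))"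

definition grad :: "('a::real_inner \<Rightarrow> real) \<Rightarrow> 'a \<Rightarrow> 'a" where
  "grad f z = (THE D. GDERIV f z :> D)"

lemma grad_eq:
  assumes "GDERIV f z :> D"
  shows "grad f z = D"
  unfolding grad_def
proof (rule the_equality[where a = D])
  show "GDERIV f z :> D" by (fact assms)
next
  fix D' assume "GDERIV f z :> D'"
  then have "(\<lambda>h. h \<bullet> D') = (\<lambda>h. h \<bullet> D)"
    unfolding gderiv_def by (rule has_derivative_unique[OF _ assms[unfolded gderiv_def]])
  from fun_cong[OF this, of "D' - D"] have "(D' - D) \<bullet> (D' - D) = 0"
    by (simp add: inner_diff_right)
  then show "D' = D" by simp
qed

definition partial_grad :: "((nat \<Rightarrow> real ^ 2) \<Rightarrow> real) \<Rightarrow> nat \<Rightarrow> (nat \<Rightarrow> real ^ 2) \<Rightarrow> real ^ 2" where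
  "partial_grad F i y = grad (\<lambda>w. F (y(i := w))) (y i)"

text \<open>
  The dissipation and the area rate are differentiated with respect to the nodal velocities, with
  the polygon \<open>x\<close> kept fixed; the energy is differentiated with respect to the nodes.
\<close>
definition vp_mcf_system ::
  "nat \<Rightarrow> (nat \<Rightarrow> real ^ 2) \<Rightarrow> (nat \<Rightarrow> real ^ 2) \<Rightarrow> real \<Rightarrow> bool" where
  "vp_mcf_system n x v l \<longleftrightarrow>
     (\<forall>i \<in> {1..n}. partial_grad (dissipation n x) i v + l *\<^sub>R partial_grad (area_rate n x) i v
        = - partial_grad (discrete_energy n) i x) \<and>
     area_rate n x v = 0"

end

theory Submission
  imports Defs
begin

text \<open>
  Pair the \<open>i\<close>-th equation of the system with \<open>x\<^sub>i'\<close> and sum over \<open>i\<close>. All three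
  functionals are sums over the edges of functions of the two end points, so the sum of the
  pairings is a sum over the edges of directional derivatives: by homogeneity it is \<open>2 \<Phi>\<close> for the
  dissipation and \<open>(S)\<^sub>t = 0\<close> for the area rate, and it is the time derivative of the length for the
  energy. The equality case is the positive definiteness of \<open>\<bar>p\<bar>\<^sup>2 + p \<bullet> q + \<bar>q\<bar>\<^sup>2\<close> on every edge.
\<close>

lemma nxt_in_range: "j \<in> {1..n} \<Longrightarrow> nxt n j \<in> {1..n}"
  by (auto simp: nxt_def)

text \<open>Chain rule along the one-node variation \<open>y(i := w)\<close>: it moves the first
  argument of summand \<open>j\<close> when \<open>j = i\<close> and the second when
  \<open>nxt n j = i\<close>. The two cases are tested separately, which avoids naming the
  predecessor of \<open>i\<close>.\<close>

lemma GDERIV_edge_sum: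
  fixes y :: "nat \<Rightarrow> real ^ 2" and f :: "nat \<Rightarrow> (real ^ 2) \<times> (real ^ 2) \<Rightarrow> real"
  assumes "\<And>j. j \<in> {1..n} \<Longrightarrow>
    (f j has_derivative (\<lambda>h. fst h \<bullet> a j + snd h \<bullet> b j)) (at (y j, y (nxt n j)))"
  shows "GDERIV (\<lambda>w. \<Sum>j = 1..n. f j ((y(i := w)) j, (y(i := w)) (nxt n j))) (y i) :>
    (\<Sum>j = 1..n. (if j = i then a j else 0) + (if nxt n j = i then b j else 0))"
proof -
  have upd: "((\<lambda>w. (y(i := w)) k) has_derivative (\<lambda>h. if k = i then h else 0)) (at (y i))" for k
    by (cases "k = i") auto
  have "((\<lambda>w. f j ((y(i := w)) j, (y(i := w)) (nxt n j))) has_derivative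
      (\<lambda>h. h \<bullet> ((if j = i then a j else 0) + (if nxt n j = i then b j else 0)))) (at (y i))"
    if "j \<in> {1..n}" for j
  proof -
    \<comment> \<open>The trivial update \<open>y(i := y i)\<close> presents the base point as the
      value of the inner map at \<open>w = y i\<close>, as the chain rule expects.\<close>
    have "(f j has_derivative (\<lambda>h. fst h \<bullet> a j + snd h \<bullet> b j))
        (at ((y(i := y i)) j, (y(i := y i)) (nxt n j)))"
      using assms[OF that] by simp
    from has_derivative_compose[OF has_derivative_Pair[OF upd[of j] upd[of "nxt n j"]] this]
    show ?thesis
      by (rule has_derivative_eq_rhs) (auto simp: inner_add_right)
  qed
  from has_derivative_sum[of "{1..n}", OF this] show ?thesis
    by (simp add: gderiv_def inner_sum_right)
qed

text \<open>Exchanging the two sums regroups the pairing by edges: edge \<open>j\<close> is seen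
  only by the nodes \<open>j\<close> and \<open>nxt n j\<close>, so it contributes the derivative of
  \<open>f j\<close> in the direction \<open>(v j, v (nxt n j))\<close>.\<close>

lemma sum_inner_partial_grad:
  fixes y v :: "nat \<Rightarrow> real ^ 2" and f :: "nat \<Rightarrow> (real ^ 2) \<times> (real ^ 2) \<Rightarrow> real"
  assumes F: "\<And>z. F z = (\<Sum>j = 1..n. f j (z j, z (nxt n j)))"
    and "\<And>j. j \<in> {1..n} \<Longrightarrow>
      (f j has_derivative (\<lambda>h. fst h \<bullet> a j + snd h \<bullet> b j)) (at (y j, y (nxt n j)))"
  shows "(\<Sum>i = 1..n. v i \<bullet> partial_grad F i y) = (\<Sum>j = 1..n. v j \<bullet> a j + v (nxt n j) \<bullet> b j)"
proof -
  have "partial_grad F i y =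
      (\<Sum>j = 1..n. (if j = i then a j else 0) + (if nxt n j = i then b j else 0))" for i
    unfolding partial_grad_def F by (rule grad_eq[OF GDERIV_edge_sum]) (use assms(2) in blast)
  then have "(\<Sum>i = 1..n. v i \<bullet> partial_grad F i y) =
      (\<Sum>i = 1..n. \<Sum>j = 1..n. (if j = i then v i \<bullet> a j else 0) + (if nxt n j = i then v i \<bullet> b j else 0))"
    by (auto simp: inner_sum_right inner_add_right intro!: sum.cong)
  also have "\<dots> = (\<Sum>j = 1..n. \<Sum>i = 1..n. (if j = i then v i \<bullet> a j else 0) + (if nxt n j = i then v i \<bullet> b j else 0))"
    by (rule sum.swap)
  also have "\<dots> = (\<Sum>j = 1..n. v j \<bullet> a j + v (nxt n j) \<bullet> b j)"
    \<comment> \<open>For fixed \<open>j\<close> the sum over \<open>i\<close> keeps the terms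
      \<open>i = j\<close> and \<open>i = nxt n j\<close>; the latter index must lie in the range of
      summation.\<close>
    using nxt_in_range[of _ n] by (intro sum.cong refl) (simp add: sum.distrib)
  finally show ?thesis .
qed

lemma integral_norm_affine_squared:
  fixes p q :: "'a::real_inner"
  shows "integral {0..1} (\<lambda>\<mu>. (norm ((1 - \<mu>) *\<^sub>R p + \<mu> *\<^sub>R q))\<^sup>2) = (p \<bullet> p + p \<bullet> q + q \<bullet> q) / 3"
proof -
  \<comment> \<open>The factors of \<open>p \<bullet> p\<close>, \<open>p \<bullet> q\<close> and
    \<open>q \<bullet> q\<close> are primitives of \<open>(1 - \<mu>)^2\<close>,
    \<open>2 * \<mu> * (1 - \<mu>)\<close> and \<open>\<mu>^2\<close>; each vanishes at 0 and equals
    1/3 at 1.\<close>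
  let ?G = "\<lambda>\<mu>::real. p \<bullet> p * (\<mu> - \<mu>^2 + \<mu>^3 / 3) + p \<bullet> q * (\<mu>^2 - 2 * \<mu>^3 / 3) + q \<bullet> q * (\<mu>^3 / 3)"
  have "((\<lambda>\<mu>. (norm ((1 - \<mu>) *\<^sub>R p + \<mu> *\<^sub>R q))\<^sup>2) has_integral (?G 1 - ?G 0)) {0..1}"
  proof (rule fundamental_theorem_of_calculus)
    fix \<mu> :: real
    have "(?G has_real_derivative (norm ((1 - \<mu>) *\<^sub>R p + \<mu> *\<^sub>R q))\<^sup>2) (at \<mu> within {0..1})"
      unfolding power2_norm_eq_inner
      by (auto intro!: derivative_eq_intros
          simp: inner_add_left inner_add_right inner_commute[of q p] algebra_simps power2_eq_square)
    then show "(?G has_vector_derivative (norm ((1 - \<mu>) *\<^sub>R p + \<mu> *\<^sub>R q))\<^sup>2) (at \<mu> within {0..1})"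
      by (simp add: has_real_derivative_iff_has_vector_derivative)
  qed simp
  then show ?thesis
    by (simp add: integral_unique field_simps)
qed

lemma integral_affine_inner:
  fixes p q m :: "'a::real_inner"
  shows "integral {0..1} (\<lambda>\<mu>. ((1 - \<mu>) *\<^sub>R p + \<mu> *\<^sub>R q) \<bullet> m) = (p + q) \<bullet> m / 2"
proof -
  let ?G = "\<lambda>\<mu>::real. p \<bullet> m * (\<mu> - \<mu>^2 / 2) + q \<bullet> m * (\<mu>^2 / 2)"
  have "((\<lambda>\<mu>. ((1 - \<mu>) *\<^sub>R p + \<mu> *\<^sub>R q) \<bullet> m) has_integral (?G 1 - ?G 0)) {0..1}"
  proof (rule fundamental_theorem_of_calculus)
    fix \<mu> :: real
    have "(?G has_real_derivative ((1 - \<mu>) *\<^sub>R p + \<mu> *\<^sub>R q) \<bullet> m) (at \<mu> within {0..1})"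
      by (auto intro!: derivative_eq_intros simp: inner_add_left algebra_simps)
    then show "(?G has_vector_derivative ((1 - \<mu>) *\<^sub>R p + \<mu> *\<^sub>R q) \<bullet> m) (at \<mu> within {0..1})"
      by (simp add: has_real_derivative_iff_has_vector_derivative)
  qed simp
  then show ?thesis
    by (simp add: integral_unique inner_add_left field_simps)
qed

text \<open>The factor 1/6 is the 1/2 of the definition times the 1/3 from the integral. This closed
  form is the sum over edges that \<open>sum_inner_partial_grad\<close> requires.\<close>

lemma dissipation_eq:
  "dissipation n x v = (\<Sum>j = 1..n. norm (edge n x j) / 6 *
    (v j \<bullet> v j + v j \<bullet> v (nxt n j) + v (nxt n j) \<bullet> v (nxt n j)))"
  unfolding dissipation_def edge_integral_def edge_velocity_def integral_norm_affine_squared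
  by (simp add: sum_distrib_left)

text \<open>The normal is constant along an edge, so only the mean of the two end velocities
  enters.\<close>

lemma area_rate_eq:
  "area_rate n x v = (\<Sum>j = 1..n. (v j + v (nxt n j)) \<bullet> (norm (edge n x j) / 2) *\<^sub>R edge_normal n x j)"
  unfolding area_rate_def edge_integral_def edge_velocity_def integral_affine_inner
  by simp

text \<open>Euler's identity for a function homogeneous of degree 2 in the velocities. The vectors
  paired with the end velocities are the two partial gradients of the quadratic form on an
  edge.\<close>

lemma sum_inner_grad_dissipation:
  "(\<Sum>i = 1..n. v i \<bullet> partial_grad (dissipation n x) i v) = 2 * dissipation n x v"
proof -
  let ?c = "\<lambda>j. norm (edge n x j) / 6"
  have "(\<Sum>i = 1..n. v i \<bullet> partial_grad (dissipation n x) i v) =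
    (\<Sum>j = 1..n. v j \<bullet> (?c j *\<^sub>R (2 *\<^sub>R v j + v (nxt n j))) +
      v (nxt n j) \<bullet> (?c j *\<^sub>R (v j + 2 *\<^sub>R v (nxt n j))))"
  proof (rule sum_inner_partial_grad
      [where f = "\<lambda>j p. ?c j * (fst p \<bullet> fst p + fst p \<bullet> snd p + snd p \<bullet> snd p)"])
    fix j
    let ?z = "(v j, v (nxt n j))"
    have "((\<lambda>p. ?c j * (fst p \<bullet> fst p + fst p \<bullet> snd p + snd p \<bullet> snd p)) has_derivative
        (\<lambda>h. ?c j * ((fst ?z \<bullet> fst h + fst h \<bullet> fst ?z) + (fst ?z \<bullet> snd h + fst h \<bullet> snd ?z) +
          (snd ?z \<bullet> snd h + snd h \<bullet> snd ?z)))) (at ?z)"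
      by (intro has_derivative_mult_right has_derivative_add has_derivative_inner
          has_derivative_fst has_derivative_snd has_derivative_ident)
    then show "((\<lambda>p. ?c j * (fst p \<bullet> fst p + fst p \<bullet> snd p + snd p \<bullet> snd p)) has_derivative
        (\<lambda>h. fst h \<bullet> (?c j *\<^sub>R (2 *\<^sub>R v j + v (nxt n j))) +
          snd h \<bullet> (?c j *\<^sub>R (v j + 2 *\<^sub>R v (nxt n j))))) (at ?z)"
      by (rule has_derivative_eq_rhs) (simp add: fun_eq_iff inner_add_right inner_commute distrib_left)
  qed (simp add: dissipation_eq)
  also have "\<dots> = 2 * dissipation n x v"
    unfolding dissipation_eq sum_distrib_left
    by (intro sum.cong refl) (simp add: inner_add_right inner_commute algebra_simps)
  finally show ?thesis .
qed

text \<open>Euler's identity in degree 1: the area rate is linear in the velocities.\<close>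

lemma sum_inner_grad_area_rate:
  "(\<Sum>i = 1..n. v i \<bullet> partial_grad (area_rate n x) i v) = area_rate n x v"
proof -
  let ?m = "\<lambda>j. (norm (edge n x j) / 2) *\<^sub>R edge_normal n x j"
  have "(\<Sum>i = 1..n. v i \<bullet> partial_grad (area_rate n x) i v) =
    (\<Sum>j = 1..n. v j \<bullet> ?m j + v (nxt n j) \<bullet> ?m j)"
    by (rule sum_inner_partial_grad[where f = "\<lambda>j p. (fst p + snd p) \<bullet> ?m j"],
        simp add: area_rate_eq, rule has_derivative_eq_rhs, (rule derivative_intros)+)
      (simp add: fun_eq_iff inner_add_left distrib_left)
  then show ?thesis
    by (simp only: area_rate_eq inner_add_left)
qed

text \<open>Away from 0 the norm has gradient \<open>sgn\<close>; the end points of an edge enter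
  with opposite signs, which recombine into \<open>edge n v j\<close>.\<close>

lemma sum_inner_grad_energy:
  assumes "\<And>j. j \<in> {1..n} \<Longrightarrow> x (nxt n j) \<noteq> x j"
  shows "(\<Sum>i = 1..n. v i \<bullet> partial_grad (discrete_energy n) i x) =
    (\<Sum>j = 1..n. edge n v j \<bullet> sgn (edge n x j))"
proof -
  have "(\<Sum>i = 1..n. v i \<bullet> partial_grad (discrete_energy n) i x) =
    (\<Sum>j = 1..n. v j \<bullet> (- sgn (edge n x j)) + v (nxt n j) \<bullet> sgn (edge n x j))"
  proof (rule sum_inner_partial_grad[where f = "\<lambda>j p. norm (snd p - fst p)"])
    fix j assume "j \<in> {1..n}"
    then have "edge n x j \<noteq> 0"
      using assms by (simp add: edge_def)
    from has_derivative_norm[OF this]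
    have "(norm has_derivative (\<lambda>h. h \<bullet> sgn (edge n x j)))
        (at (snd (x j, x (nxt n j)) - fst (x j, x (nxt n j))))"
      by (simp add: edge_def inner_commute)
    moreover have "((\<lambda>p. snd p - fst p) has_derivative (\<lambda>h. snd h - fst h)) (at (x j, x (nxt n j)))"
      by (auto intro!: derivative_eq_intros)
    ultimately have "((\<lambda>p. norm (snd p - fst p)) has_derivative
        (\<lambda>h. (snd h - fst h) \<bullet> sgn (edge n x j))) (at (x j, x (nxt n j)))"
      by (rule has_derivative_compose[rotated])
    then show "((\<lambda>p. norm (snd p - fst p)) has_derivative
        (\<lambda>h. fst h \<bullet> (- sgn (edge n x j)) + snd h \<bullet> sgn (edge n x j))) (at (x j, x (nxt n j)))"
      by (simp add: inner_diff_left)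
  qed (simp add: discrete_energy_def edge_def)
  then show ?thesis
    by (simp add: edge_def inner_diff_left)
qed

text \<open>Chain rule for the norm of each edge. The derivative is written exactly as the right
  side of \<open>sum_inner_grad_energy\<close>, so that the two can be compared.\<close>

lemma discrete_energy_has_derivative:
  assumes "\<And>j. j \<in> {1..n} \<Longrightarrow> (x j has_vector_derivative v j) (at t within T)"
    and "\<And>j. j \<in> {1..n} \<Longrightarrow> x (nxt n j) t \<noteq> x j t"
  shows "((\<lambda>s. discrete_energy n (\<lambda>i. x i s)) has_real_derivative
    (\<Sum>j = 1..n. edge n v j \<bullet> sgn (edge n (\<lambda>i. x i t) j))) (at t within T)"
  unfolding discrete_energy_def
proof (rule DERIV_sum)
  fix j assume j: "j \<in> {1..n}"
  have "((\<lambda>s. edge n (\<lambda>i. x i s) j) has_vector_derivative edge n v j) (at t within T)"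
    unfolding edge_def
    by (intro has_vector_derivative_diff assms(1) j nxt_in_range)
  moreover have "(norm has_derivative (\<lambda>h. h \<bullet> sgn (edge n (\<lambda>i. x i t) j))) (at (edge n (\<lambda>i. x i t) j))"
    using has_derivative_norm[of "edge n (\<lambda>i. x i t) j"] assms(2)[OF j]
    by (simp add: edge_def inner_commute)
  ultimately have "((\<lambda>s. norm (edge n (\<lambda>i. x i s) j)) has_derivative
      (\<lambda>h. (h *\<^sub>R edge n v j) \<bullet> sgn (edge n (\<lambda>i. x i t) j))) (at t within T)"
    unfolding has_vector_derivative_def by (rule has_derivative_compose)
  then show "((\<lambda>s. norm (edge n (\<lambda>i. x i s) j)) has_real_derivative
      edge n v j \<bullet> sgn (edge n (\<lambda>i. x i t) j)) (at t within T)"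
    by (simp add: has_field_derivative_def mult.commute[of _ "_ \<bullet> _"] fun_eq_iff)
qed

text \<open>The two sides differ by half of \<open>(p + q) \<bullet> (p + q)\<close>.\<close>

lemma inner_form_ge:
  fixes p q :: "'a::real_inner"
  shows "(p \<bullet> p + q \<bullet> q) / 2 \<le> p \<bullet> p + p \<bullet> q + q \<bullet> q"
proof -
  have "0 \<le> (p + q) \<bullet> (p + q)" by simp
  then show ?thesis by (simp add: inner_add_left inner_add_right inner_commute)
qed

lemma dissipation_nonneg: "0 \<le> dissipation n x v"
  unfolding dissipation_eq
proof (intro sum_nonneg mult_nonneg_nonneg)
  fix j
  have "0 \<le> (v j \<bullet> v j + v (nxt n j) \<bullet> v (nxt n j)) / 2" by simp
  also note inner_form_ge
  finally show "0 \<le> v j \<bullet> v j + v j \<bullet> v (nxt n j) + v (nxt n j) \<bullet> v (nxt n j)" .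
qed simp

lemma dissipation_eq_0_iff:
  assumes "\<And>j. j \<in> {1..n} \<Longrightarrow> x (nxt n j) \<noteq> x j"
  shows "dissipation n x v = 0 \<longleftrightarrow> (\<forall>i \<in> {1..n}. v i = 0)"
proof
  assume "\<forall>i \<in> {1..n}. v i = 0"
  then show "dissipation n x v = 0"
    unfolding dissipation_eq using nxt_in_range by (intro sum.neutral ballI) auto
next
  assume *: "dissipation n x v = 0"
  show "\<forall>i \<in> {1..n}. v i = 0"
  proof
    fix i assume i: "i \<in> {1..n}"
    let ?g = "\<lambda>j. v j \<bullet> v j + v j \<bullet> v (nxt n j) + v (nxt n j) \<bullet> v (nxt n j)"
    \<comment> \<open>Only the square at the first end point is kept. This suffices, since every
      node \<open>i\<close> is the first end point of edge \<open>i\<close>.\<close>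
    have lower: "v j \<bullet> v j / 2 \<le> ?g j" for j
      using inner_form_ge[of "v j" "v (nxt n j)"] inner_ge_zero[of "v (nxt n j)"] by argo
    have "0 \<le> ?g j" for j
      using lower[of j] inner_ge_zero[of "v j"] by argo
    \<comment> \<open>A vanishing sum of nonnegative terms vanishes termwise; the positive length of
      the edge can then be cancelled.\<close>
    then have "norm (edge n x i) / 6 * ?g i = 0"
      using * i unfolding dissipation_eq
      by (subst (asm) sum_nonneg_eq_0_iff) auto
    moreover have "edge n x i \<noteq> 0"
      using assms[OF i] by (simp add: edge_def)
    ultimately have "?g i = 0" by simp
    then show "v i = 0"
      using lower[of i] inner_ge_zero[of "v i"] inner_eq_zero_iff[of "v i"] by argo
  qed
qed

text \<open>The multiplier does no work: paired with the velocities, its term is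
  \<open>l * area_rate n x v\<close>, which the area constraint makes zero.\<close>

lemma vp_mcf_system_energy_identity:
  assumes "vp_mcf_system n x v l" and "\<And>j. j \<in> {1..n} \<Longrightarrow> x (nxt n j) \<noteq> x j"
  shows "(\<Sum>j = 1..n. edge n v j \<bullet> sgn (edge n x j)) = - 2 * dissipation n x v"
proof -
  have "(\<Sum>i = 1..n. v i \<bullet> (partial_grad (dissipation n x) i v + l *\<^sub>R partial_grad (area_rate n x) i v))
      = (\<Sum>i = 1..n. v i \<bullet> - partial_grad (discrete_energy n) i x)"
    using assms(1) unfolding vp_mcf_system_def by (intro sum.cong refl) simp
  moreover have "(\<Sum>i = 1..n. v i \<bullet> (partial_grad (dissipation n x) i v + l *\<^sub>R partial_grad (area_rate n x) i v))
      = 2 * dissipation n x v + l * area_rate n x v"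
    using sum_inner_grad_dissipation[where n = n and x = x and v = v]
      sum_inner_grad_area_rate[where n = n and x = x and v = v]
    by (simp add: inner_add_right sum.distrib flip: sum_distrib_left)
  moreover have "area_rate n x v = 0"
    using assms(1) by (simp add: vp_mcf_system_def)
  ultimately show ?thesis
    using sum_inner_grad_energy[of n x v] assms(2) by (simp add: sum_negf)
qed

theorem theorem4p1:
  fixes n :: nat and T :: "real set"
    and x x' :: "nat \<Rightarrow> real \<Rightarrow> real ^ 2" and l :: "real \<Rightarrow> real"
  assumes "n \<ge> 3"
    and "is_interval T" and "\<exists>a \<in> T. \<exists>b \<in> T. a < b"
    and "\<forall>t \<in> T. \<forall>i \<in> {1..n}. (x i has_vector_derivative x' i t) (at t within T)"
    and "\<forall>t \<in> T. \<forall>i \<in> {1..n}. x (nxt n i) t \<noteq> x i t"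
    and "\<forall>t \<in> T. vp_mcf_system n (\<lambda>i. x i t) (\<lambda>i. x' i t) (l t)"
  shows "\<forall>t \<in> T.
    ((\<lambda>s. discrete_energy n (\<lambda>i. x i s)) has_real_derivative
        - 2 * dissipation n (\<lambda>i. x i t) (\<lambda>i. x' i t)) (at t within T) \<and>
    - 2 * dissipation n (\<lambda>i. x i t) (\<lambda>i. x' i t) \<le> 0 \<and>
    (((\<lambda>s. discrete_energy n (\<lambda>i. x i s)) has_real_derivative 0) (at t within T) \<longleftrightarrow>
        (\<forall>i \<in> {1..n}. x' i t = 0))"
proof
  fix t assume t: "t \<in> T"
  let ?E = "\<lambda>s. discrete_energy n (\<lambda>i. x i s)"
  let ?D = "dissipation n (\<lambda>i. x i t) (\<lambda>i. x' i t)"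
  have noncoincident: "\<And>j. j \<in> {1..n} \<Longrightarrow> x (nxt n j) t \<noteq> x j t"
    using assms(5) t by blast
  have "(?E has_real_derivative
      (\<Sum>j = 1..n. edge n (\<lambda>i. x' i t) j \<bullet> sgn (edge n (\<lambda>i. x i t) j))) (at t within T)"
    using assms(4) t noncoincident by (intro discrete_energy_has_derivative) auto
  also have "(\<Sum>j = 1..n. edge n (\<lambda>i. x' i t) j \<bullet> sgn (edge n (\<lambda>i. x i t) j)) = - 2 * ?D"
    using assms(6) t noncoincident by (intro vp_mcf_system_energy_identity) auto
  finally have deriv: "(?E has_real_derivative - 2 * ?D) (at t within T)" .
  \<comment> \<open>A connected set with two distinct points has no isolated point. Hence the
    derivative within \<open>T\<close> is unique, also at an end point of the interval, and a zero
    derivative forces \<open>?D = 0\<close>.\<close>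
  have "t islimpt T"
    using assms(2,3) t by (intro connected_imp_perfect) (auto simp: is_interval_connected)
  then have "at t within T \<noteq> bot"
    by (simp add: trivial_limit_within)
  then have "(?E has_real_derivative 0) (at t within T) \<longleftrightarrow> ?D = 0"
    using deriv vector_derivative_unique_within[of t T ?E "- 2 * ?D" 0]
    by (auto simp: has_real_derivative_iff_has_vector_derivative)
  also have "\<dots> \<longleftrightarrow> (\<forall>i \<in> {1..n}. x' i t = 0)"
    using noncoincident by (rule dissipation_eq_0_iff)
  finally show "(?E has_real_derivative - 2 * ?D) (at t within T) \<and> - 2 * ?D \<le> 0 \<and>
      ((?E has_real_derivative 0) (at t within T) \<longleftrightarrow> (\<forall>i \<in> {1..n}. x' i t = 0))"
    using deriv dissipation_nonneg[of n] by simp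
qed

end
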